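(* Let $X$ be a finite cubical complex (a finite subcomplex of the cubical complex $\mathbb{Z}^d$, or a discrete torus $\mathbb{T}^d_N$), let $q\ge 2$ be an integer, let $0\le\beta<\infty$, and put $p=1-e^{-\beta}$. Let $\mathcal{M}$ be the plaquette Swendsen--Wang Markov chain on the finite state space $C^1(X;\mathbb{Z}(q))$ with parameters $p$ and $q$, and let $\nu$ be the $q$-state Potts lattice gauge theory on $X$ with inverse temperature $\beta$. Then $\nu$ is a reversible distribution for $\mathcal{M}$, i.e. $\nu(f)\,\mathbf{P}(f^*\mid f)=\nu(f^* )\,\mathbf{P}(f\mid f^* )$ for all $f,f^*\in C^1(X;\mathbb{Z}(q))$, where $\mathbf{P}(f^*\mid f)$ denotes the one-step transition probability of $\mathcal{M}$ from $f$ to $f^*$; consequently, $\nu$ is the unique stationary distribution of $\mathcal{M}$.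
   Context: **Cubical complexes.** $\mathbb{Z}^d$ is regarded as the cubical complex tiling $\mathbb{R}^d$ by unit $d$-cubes with corners at integer points; its $0$-cells are vertices, its $1$-cells are edges, and its $2$-cells are unit squares, called plaquettes. The discrete torus $\mathbb{T}^d_N$ is obtained from $[0,N]^d\subset\mathbb{Z}^d$ by identifying opposite faces. Write $V_X$, $E_X$, $U_X$ for the finite sets of vertices, edges and plaquettes of $X$. **Cochains.** $\mathbb{Z}(q)$ is the multiplicative group of complex $q$-th roots of unity. $C^1(X;\mathbb{Z}(q))$ is the finite group of functions $f$ assigning an element of $\mathbb{Z}(q)$ to each oriented edge of $X$, such that reversing the orientation of an edge inverts its value (equivalently, after fixing one orientation for each edge, all functions $E_X\to\mathbb{Z}(q)$). For $f\in C^1(X;\mathbb{Z}(q))$ and an oriented plaquette $x$, the coboundary $(\delta^1 f)(x)\in\mathbb{Z}(q)$ is the oriented product of the values of $f$ on the four edges bounding $x$: if $x$ has vertices $a,b,d,c$ in cyclic order, then $(\delta^1 f)(x)=f(\{ab\})\,f(\{ac\})^{-1}\,f(\{bd\})\,f(\{cd\})^{-1}$, where $\{uv\}$ is the edge oriented from $u$ to $v$. The condition $(\delta^1 f)(x)=1$ does not depend on the chosen orientation of $x$. **Potts lattice gauge theory.** The $q$-state Potts lattice gauge theory on $X$ with inverse temperature $\beta$ is the probability measure on $C^1(X;\mathbb{Z}(q))$ $$\nu(f)=\frac{1}{\mathcal{Z}}e^{-\beta \mathbf{H}(f)},\qquad \mathbf{H}(f)=-\sum_{x\in U_X}\mathbf{1}_{\delta^1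 f(x)=1},\qquad \mathcal{Z}=\sum_{g\in C^1(X;\mathbb{Z}(q))}e^{-\beta \mathbf{H}(g)}.$$ **Percolation subcomplexes and cocycles.** A percolation subcomplex $P$ of $X$ consists of all vertices and all edges of $X$ together with a subset $U_P\subseteq U_X$ of its plaquettes. Set $Z^1(P;\mathbb{Z}(q))=\{f\in C^1(X;\mathbb{Z}(q)) : (\delta^1 f)(x)=1\text{ for all }x\in U_P\}$. **Plaquette Swendsen--Wang chain $\mathcal{M}$.** Given the current state $f_t\in C^1(X;\mathbb{Z}(q))$, the next state $f_{t+1}$ is generated as follows. 1. Independently for each plaquette $x\in U_X$: if $\delta^1 f_t(x)\neq 1$, set $\omega_{t+1}(x)=0$; if $\delta^1 f_t(x)=1$, set $\omega_{t+1}(x)=1$ with probability $p$ and $\omega_{t+1}(x)=0$ with probability $1-p$. 2. Let $P_{t+1}$ be the percolation subcomplex with plaquette set $\{x\in U_X:\omega_{t+1}(x)=1\}$. 3. Sample $f_{t+1}$ uniformly at random from the finite group $Z^1(P_{t+1};\mathbb{Z}(q))$. *)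

theory Defs
  imports "HOL-Probability.Probability"
begin

section \<open>Finite cubical complexes\<close>

text \<open>
  A cell is a pair (v, I): the translate by v of the unit cube spanned by the coordinate
  directions in I, so that its dimension is the cardinality of I. Lattice points of dimension d
  are integer lists of length d, and directions are numbered 0, ..., d - 1.
  Endpoints are not used to identify cells, since in a torus of side 1 or 2 distinct cells can
  have the same vertices. The field \<open>nbr\<close> tells which vertex is reached from a given one by
  a unit step in a given coordinate direction.
\<close>

type_synonym vertex = "int list"
type_synonym cell = "vertex \<times> nat set"

record cubical_complex =
  cells :: "cell set"
  nbr :: "vertex \<Rightarrow> nat \<Rightarrow> vertex"

definition unit_step :: "vertex \<Rightarrow> nat \<Rightarrow> vertex" where
  "unit_step v i = v[i := v ! i + 1]"

definition lattice_cells :: "nat \<Rightarrow> cell set" where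
  "lattice_cells d = {(v, I). length v = d \<and> I \<subseteq> {..<d}}"

definition finite_lattice_subcomplex :: "nat \<Rightarrow> cubical_complex \<Rightarrow> bool" where
  "finite_lattice_subcomplex d X \<longleftrightarrow>
     finite (cells X) \<and> cells X \<subseteq> lattice_cells d \<and> nbr X = unit_step \<and>
     (\<forall>(v, I) \<in> cells X. \<forall>i\<in>I. (v, I - {i}) \<in> cells X \<and> (unit_step v i, I - {i}) \<in> cells X)"

definition box_cells :: "nat \<Rightarrow> nat \<Rightarrow> cell set" where
  "box_cells d N = {(v, I) \<in> lattice_cells d.
     \<forall>k<d. 0 \<le> v ! k \<and> v ! k + (if k \<in> I then 1 else 0) \<le> int N}"

text \<open>Two cells of the box are identified in the torus iff they become equal after reducing the
  coordinates of the base point modulo N.\<close>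

definition reduce :: "nat \<Rightarrow> vertex \<Rightarrow> vertex" where
  "reduce N v = map (\<lambda>k. k mod int N) v"

definition torus :: "nat \<Rightarrow> nat \<Rightarrow> cubical_complex" where
  "torus d N = \<lparr> cells = (\<lambda>(v, I). (reduce N v, I)) ` box_cells d N,
                 nbr = (\<lambda>v i. reduce N (unit_step v i)) \<rparr>"

definition finite_cubical_complex :: "nat \<Rightarrow> cubical_complex \<Rightarrow> bool" where
  "finite_cubical_complex d X \<longleftrightarrow>
     finite_lattice_subcomplex d X \<or> (\<exists>N\<ge>1. X = torus d N)"

definition edges :: "cubical_complex \<Rightarrow> cell set" where
  "edges X = {c \<in> cells X. card (snd c) = 1}"

definition plaquettes :: "cubical_complex \<Rightarrow> cell set" where
  "plaquettes X = {c \<in> cells X. card (snd c) = 2}"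

section \<open>Cochains with values in the q-th roots of unity\<close>

definition roots_of_unity :: "nat \<Rightarrow> complex set" where
  "roots_of_unity q = {z. z ^ q = 1}"

text \<open>In an oriented edge (e, s), s is true for the orientation in the positive coordinate
  direction.\<close>

type_synonym oriented_edge = "cell \<times> bool"
type_synonym cochain = "oriented_edge \<Rightarrow> complex"

definition oriented_edges :: "cubical_complex \<Rightarrow> oriented_edge set" where
  "oriented_edges X = edges X \<times> UNIV"

definition rev_edge :: "oriented_edge \<Rightarrow> oriented_edge" where
  "rev_edge e = (fst e, \<not> snd e)"

text \<open>The extensional function space makes a cochain determined by its values on the oriented
  edges of X.\<close>

definition cochains :: "nat \<Rightarrow> cubical_complex \<Rightarrow> cochain set" where
  "cochains q X = {f \<in> oriented_edges X \<rightarrow>\<^sub>E roots_of_unity q.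
     \<forall>e \<in> oriented_edges X. f (rev_edge e) = inverse (f e)}"

text \<open>The oriented plaquette (v, i, j) has base point a = v and vertices a, b, d, c in cyclic
  order, where b and c are the neighbours of a in directions i and j. The two orientations of the
  plaquette (v, {i, j}) are (v, i, j) and (v, j, i).\<close>

definition coboundary :: "cubical_complex \<Rightarrow> cochain \<Rightarrow> vertex \<times> nat \<times> nat \<Rightarrow> complex" where
  "coboundary X f = (\<lambda>(v, i, j).
     let ab = ((v, {i}), True);
         ac = ((v, {j}), True);
         bd = ((nbr X v i, {j}), True);
         cd = ((nbr X v j, {i}), True)
     in f ab * inverse (f ac) * f bd * inverse (f cd))"

lemma coboundary_reverse: "coboundary X f (v, j, i) = inverse (coboundary X f (v, i, j))"
  by (simp add: coboundary_def Let_def mult_ac)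

definition flat_at :: "cubical_complex \<Rightarrow> cochain \<Rightarrow> cell \<Rightarrow> bool" where
  "flat_at X f x \<longleftrightarrow> coboundary X f (fst x, Min (snd x), Max (snd x)) = 1"

lemma flat_at_iff:
  assumes "i \<noteq> j"
  shows "flat_at X f (v, {i, j}) \<longleftrightarrow> coboundary X f (v, i, j) = 1"
proof (cases "i < j")
  case True
  then show ?thesis by (simp add: flat_at_def min_def max_def)
next
  case False
  then show ?thesis using assms coboundary_reverse[of X f v j i]
    by (simp add: flat_at_def min_def max_def)
qed

definition cocycles :: "nat \<Rightarrow> cubical_complex \<Rightarrow> cochain set" where
  "cocycles q X = {f \<in> cochains q X. \<forall>x \<in> plaquettes X. flat_at X f x}"

section \<open>Potts lattice gauge theory\<close>

definition potts_energy :: "cubical_complex \<Rightarrow> cochain \<Rightarrow> real" where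
  "potts_energy X f = - (\<Sum>x \<in> plaquettes X. if flat_at X f x then 1 else 0)"

definition partition_function :: "nat \<Rightarrow> cubical_complex \<Rightarrow> real \<Rightarrow> real" where
  "partition_function q X \<beta> = (\<Sum>g \<in> cochains q X. exp (- \<beta> * potts_energy X g))"

definition potts_gauge :: "nat \<Rightarrow> cubical_complex \<Rightarrow> real \<Rightarrow> cochain pmf" where
  "potts_gauge q X \<beta> = embed_pmf (\<lambda>f. if f \<in> cochains q X
     then exp (- \<beta> * potts_energy X f) / partition_function q X \<beta> else 0)"

section \<open>The plaquette Swendsen--Wang chain\<close>

definition percolation_subcomplex :: "cubical_complex \<Rightarrow> cell set \<Rightarrow> cubical_complex" where
  "percolation_subcomplex X U = X \<lparr> cells := {c \<in> cells X. card (snd c) \<le> 1} \<union> U \<rparr>"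

definition swendsen_wang :: "nat \<Rightarrow> cubical_complex \<Rightarrow> real \<Rightarrow> cochain \<Rightarrow> cochain pmf" where
  "swendsen_wang q X p f = do {
     \<omega> \<leftarrow> Pi_pmf (plaquettes X) False
            (\<lambda>x. if flat_at X f x then bernoulli_pmf p else return_pmf False);
     pmf_of_set (cocycles q (percolation_subcomplex X {x \<in> plaquettes X. \<omega> x}))
   }"

section \<open>Reversible and stationary distributions of a Markov chain on S with kernel K\<close>

definition reversible_distribution :: "'s set \<Rightarrow> ('s \<Rightarrow> 's pmf) \<Rightarrow> 's pmf \<Rightarrow> bool" where
  "reversible_distribution S K \<mu> \<longleftrightarrow> set_pmf \<mu> \<subseteq> S \<and>
     (\<forall>s\<in>S. \<forall>t\<in>S. pmf \<mu> s * pmf (K s) t = pmf \<mu> t * pmf (K t) s)"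

definition stationary_distribution :: "'s set \<Rightarrow> ('s \<Rightarrow> 's pmf) \<Rightarrow> 's pmf \<Rightarrow> bool" where
  "stationary_distribution S K \<mu> \<longleftrightarrow> set_pmf \<mu> \<subseteq> S \<and> bind_pmf \<mu> K = \<mu>"

section \<open>Well-definedness\<close>

lemma finite_cells:
  assumes "finite_cubical_complex d X"
  shows "finite (cells X)"
proof -
  have "finite (box_cells d N)" for N
  proof (rule finite_subset)
    show "box_cells d N \<subseteq> {v. set v \<subseteq> {0..int N} \<and> length v = d} \<times> Pow {..<d}"
    proof
      fix c assume "c \<in> box_cells d N"
      then obtain v I where c: "c = (v, I)" "length v = d" "I \<subseteq> {..<d}"
        and b: "\<And>k. k < d \<Longrightarrow> 0 \<le> v ! k \<and> v ! k + (if k \<in> I then 1 else 0) \<le> int N"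
        by (auto simp: box_cells_def lattice_cells_def)
      have "0 \<le> v ! k \<and> v ! k \<le> int N" if "k < d" for k
        using b[OF that] by (simp split: if_splits)
      then have "set v \<subseteq> {0..int N}"
        using c(2) by (auto simp: in_set_conv_nth)
      then show "c \<in> {v. set v \<subseteq> {0..int N} \<and> length v = d} \<times> Pow {..<d}"
        using c by simp
    qed
    show "finite ({v. set v \<subseteq> {0..int N} \<and> length v = d} \<times> Pow {..<d})"
      by (simp add: finite_lists_length_eq)
  qed
  then show ?thesis
    using assms by (auto simp: finite_cubical_complex_def finite_lattice_subcomplex_def torus_def)
qed

lemma finite_plaquettes: "finite_cubical_complex d X \<Longrightarrow> finite (plaquettes X)"
  using finite_cells by (simp add: plaquettes_def)

lemma cells_torus:
  assumes "N \<ge> 1"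
  shows "cells (torus d N) = {(v, I). length v = d \<and> set v \<subseteq> {0..<int N} \<and> I \<subseteq> {..<d}}"
proof (intro set_eqI iffI)
  fix c assume "c \<in> cells (torus d N)"
  then show "c \<in> {(v, I). length v = d \<and> set v \<subseteq> {0..<int N} \<and> I \<subseteq> {..<d}}"
    using assms by (auto simp: torus_def reduce_def box_cells_def lattice_cells_def)
next
  fix c assume "c \<in> {(v, I). length v = d \<and> set v \<subseteq> {0..<int N} \<and> I \<subseteq> {..<d}}"
  then obtain v I where c: "c = (v, I)" "length v = d" "set v \<subseteq> {0..<int N}" "I \<subseteq> {..<d}"
    by auto
  have nth: "0 \<le> v ! k \<and> v ! k < int N" if "k < d" for k
    using c that nth_mem[of k v] by fastforce
  have "reduce N v = v"
    unfolding reduce_def using nth c(2) by (intro nth_equalityI) auto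
  moreover have "(v, I) \<in> box_cells d N"
    using c nth by (force simp: box_cells_def lattice_cells_def)
  ultimately show "c \<in> cells (torus d N)"
    using c(1) by (force simp: torus_def)
qed

lemma finite_cochains:
  assumes "finite_cubical_complex d X" "q \<ge> 1"
  shows "finite (cochains q X)"
proof (rule finite_subset)
  show "cochains q X \<subseteq> oriented_edges X \<rightarrow>\<^sub>E roots_of_unity q"
    by (auto simp: cochains_def)
  have "finite (oriented_edges X)"
    using finite_cells[OF assms(1)] by (simp add: oriented_edges_def edges_def)
  moreover have "finite (roots_of_unity q)"
    using assms(2) finite_roots_unity[of q] by (simp add: roots_of_unity_def)
  ultimately show "finite (oriented_edges X \<rightarrow>\<^sub>E roots_of_unity q)"
    by (intro finite_PiE) auto
qed

lemma cochains_not_empty: "cochains q X \<noteq> {}"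
proof -
  have "restrict (\<lambda>_. 1) (oriented_edges X) \<in> cochains q X"
    by (auto simp: cochains_def roots_of_unity_def oriented_edges_def rev_edge_def)
  then show ?thesis by auto
qed

lemma pmf_potts_gauge:
  assumes "finite_cubical_complex d X" "q \<ge> 1"
  shows "pmf (potts_gauge q X \<beta>) f = (if f \<in> cochains q X
     then exp (- \<beta> * potts_energy X f) / partition_function q X \<beta> else 0)"
proof -
  let ?C = "cochains q X" and ?Z = "partition_function q X \<beta>"
  let ?g = "\<lambda>f. if f \<in> ?C then exp (- \<beta> * potts_energy X f) / ?Z else 0"
  have fin: "finite ?C" using finite_cochains[OF assms] .
  have Z: "?Z > 0"
    unfolding partition_function_def using fin cochains_not_empty by (intro sum_pos) auto
  have nn: "0 \<le> ?g f" for f using Z by simp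
  have "(\<integral>\<^sup>+ f. ennreal (?g f) \<partial>count_space UNIV) = (\<Sum>f\<in>?C. ennreal (?g f))"
    by (rule nn_integral_count_space'[OF fin]) auto
  also have "\<dots> = ennreal (\<Sum>f\<in>?C. ?g f)"
    by (rule sum_ennreal) (rule nn)
  also have "(\<Sum>f\<in>?C. ?g f) = 1"
    using Z by (simp add: partition_function_def flip: sum_divide_distrib)
  finally show ?thesis
    unfolding potts_gauge_def by (intro pmf_embed_pmf nn) simp
qed

lemma percolation_subcomplex_cochains:
  assumes "U \<subseteq> plaquettes X"
  shows "cochains q (percolation_subcomplex X U) = cochains q X"
proof -
  have "edges (percolation_subcomplex X U) = edges X"
    using assms by (auto simp: edges_def percolation_subcomplex_def plaquettes_def)
  then show ?thesis by (simp add: cochains_def oriented_edges_def)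
qed

lemma percolation_subcomplex_cocycles:
  assumes "U \<subseteq> plaquettes X"
  shows "cocycles q (percolation_subcomplex X U) = {f \<in> cochains q X. \<forall>x\<in>U. flat_at X f x}"
proof -
  have "plaquettes (percolation_subcomplex X U) = U"
    using assms by (auto simp: percolation_subcomplex_def plaquettes_def)
  moreover have "flat_at (percolation_subcomplex X U) = flat_at X"
    by (simp add: fun_eq_iff flat_at_def coboundary_def percolation_subcomplex_def)
  ultimately show ?thesis
    by (simp add: cocycles_def percolation_subcomplex_cochains[OF assms])
qed

lemma finite_cubical_complex_plaquette:
  assumes "finite_cubical_complex d X" "(v, {i, j}) \<in> plaquettes X"
  shows "{(v, {i}), (v, {j}), (nbr X v i, {j}), (nbr X v j, {i})} \<subseteq> edges X"
proof -
  have ij: "i \<noteq> j" and c: "(v, {i, j}) \<in> cells X"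
    using assms(2) by (auto simp: plaquettes_def card_insert_if split: if_splits)
  consider "finite_lattice_subcomplex d X" | N where "N \<ge> 1" "X = torus d N"
    using assms(1) by (auto simp: finite_cubical_complex_def)
  then show ?thesis
  proof cases
    case 1
    then have "\<forall>k\<in>{i, j}. (v, {i, j} - {k}) \<in> cells X \<and> (nbr X v k, {i, j} - {k}) \<in> cells X"
      using c unfolding finite_lattice_subcomplex_def by auto
    moreover have "{i, j} - {i} = {j}" "{i, j} - {j} = {i}" using ij by auto
    ultimately show ?thesis by (auto simp: edges_def)
  next
    case 2
    have "set (reduce N w) \<subseteq> {0..<int N}" for w
      using 2(1) by (auto simp: reduce_def)
    moreover have "length (reduce N (unit_step v k)) = length v" for k
      by (simp add: reduce_def unit_step_def)
    moreover have "nbr X v k = reduce N (unit_step v k)" for k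
      using 2 by (simp add: torus_def)
    ultimately show ?thesis
      using c cells_torus[OF 2(1), of d] 2(2) by (auto simp: edges_def)
  qed
qed

lemma cocycles_percolation_not_empty:
  assumes "finite_cubical_complex d X" "U \<subseteq> plaquettes X"
  shows "cocycles q (percolation_subcomplex X U) \<noteq> {}"
proof -
  let ?f = "restrict (\<lambda>_. 1) (oriented_edges X) :: cochain"
  have "flat_at X ?f x" if "x \<in> plaquettes X" for x
  proof -
    obtain v i j where x: "x = (v, {i, j})" "i \<noteq> j"
      using \<open>x \<in> plaquettes X\<close> by (cases x) (auto simp: plaquettes_def card_2_iff)
    then have "coboundary X ?f (v, i, j) = 1"
      using finite_cubical_complex_plaquette[OF assms(1), of v i j] that
      by (simp add: coboundary_def oriented_edges_def)
    then show ?thesis using x flat_at_iff by simp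
  qed
  moreover have "?f \<in> cochains q X"
    by (auto simp: cochains_def roots_of_unity_def oriented_edges_def rev_edge_def)
  ultimately show ?thesis
    using assms(2) unfolding percolation_subcomplex_cocycles[OF assms(2)] by blast
qed

lemma set_pmf_swendsen_wang:
  assumes "finite_cubical_complex d X" "q \<ge> 1"
  shows "set_pmf (swendsen_wang q X p f) \<subseteq> cochains q X"
proof -
  have *: "{x \<in> plaquettes X. \<omega> x} \<subseteq> plaquettes X" for \<omega> :: "cell \<Rightarrow> bool"
    by auto
  have "finite (cocycles q (percolation_subcomplex X {x \<in> plaquettes X. \<omega> x}))" for \<omega>
    using finite_cochains[OF assms] by (simp add: percolation_subcomplex_cocycles[OF *])
  then show ?thesis
    using cocycles_percolation_not_empty[OF assms(1) *]
    by (auto simp: swendsen_wang_def percolation_subcomplex_cocycles[OF *])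
qed

end

theory Submission
  imports Defs
begin

text \<open>
  Writing \<open>F f\<close> for the set of plaquettes on which \<open>f\<close> is flat, the joint weight of a state \<open>f\<close>
  and a percolation \<open>\<omega>\<close> with open set \<open>U\<close> is, up to the normalization,
  \<open>exp (\<beta> |F f|) p ^ |U| (1 - p) ^ (|F f| - |U|) = (exp \<beta> - 1) ^ |U|\<close> if \<open>U \<subseteq> F f\<close> and zero
  otherwise. So \<open>\<nu>(f) \<P>(g | f)\<close> is a sum over \<open>\<omega>\<close> of terms symmetric in \<open>f\<close> and \<open>g\<close>, which
  is reversibility. Since \<open>p < 1\<close>, all plaquettes are closed with positive probability, so every
  transition has positive probability. For two stationary distributions \<open>\<mu>\<close> and \<open>\<nu>\<close> of such a
  chain, take the largest \<open>c\<close> with \<open>\<mu> \<ge> c \<nu>\<close>: the invariant vector \<open>\<mu> - c \<nu> \<ge> 0\<close> has a zero,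
  hence vanishes.
\<close>

lemma sum_pmf_subset_eq_1:
  assumes "finite S" "set_pmf \<mu> \<subseteq> S"
  shows "(\<Sum>s\<in>S. pmf \<mu> s) = 1"
  using assms by (simp add: sum_pmf_eq_1)

lemma pmf_bind_finite:
  assumes "finite S" "set_pmf \<mu> \<subseteq> S"
  shows "pmf (bind_pmf \<mu> K) t = (\<Sum>s\<in>S. pmf \<mu> s * pmf (K s) t)"
  unfolding pmf_bind using assms
  by (subst integral_measure_pmf_real[of S]) (auto simp: mult.commute)

text \<open>Summing detailed balance over the source state pulls out \<open>pmf \<mu> t\<close> and
  leaves the total mass of \<open>K t\<close>, which is 1 because \<open>K t\<close> is supported in
  \<open>S\<close>.\<close>

lemma reversible_imp_stationary:
  assumes fin: "finite S" and rev: "reversible_distribution S K \<mu>"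
    and K: "\<And>s. s \<in> S \<Longrightarrow> set_pmf (K s) \<subseteq> S"
  shows "stationary_distribution S K \<mu>"
proof -
  have \<mu>: "set_pmf \<mu> \<subseteq> S"
    using rev by (simp add: reversible_distribution_def)
  have "pmf (bind_pmf \<mu> K) t = pmf \<mu> t" for t
  proof (cases "t \<in> S")
    case True
    have "pmf (bind_pmf \<mu> K) t = (\<Sum>s\<in>S. pmf \<mu> t * pmf (K t) s)"
      using rev True unfolding pmf_bind_finite[OF fin \<mu>] reversible_distribution_def
      by (intro sum.cong) auto
    then show ?thesis
      using sum_pmf_subset_eq_1[OF fin K[OF True]] by (simp flip: sum_distrib_left)
  next
    case False
    then have "t \<notin> set_pmf (bind_pmf \<mu> K)" "t \<notin> set_pmf \<mu>"
      using \<mu> K by auto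
    then show ?thesis
      by (metis set_pmf_iff)
  qed
  then show ?thesis
    using \<mu> by (simp add: stationary_distribution_def pmf_eqI)
qed

lemma stationary_distribution_unique:
  assumes fin: "finite S" and K: "\<And>s. s \<in> S \<Longrightarrow> S \<subseteq> set_pmf (K s)"
    and \<mu>: "stationary_distribution S K \<mu>" and \<nu>: "stationary_distribution S K \<nu>"
  shows "\<mu> = \<nu>"
proof -
  have sub: "set_pmf \<mu> \<subseteq> S" "set_pmf \<nu> \<subseteq> S"
    and inv: "bind_pmf \<mu> K = \<mu>" "bind_pmf \<nu> K = \<nu>"
    using \<mu> \<nu> by (auto simp: stationary_distribution_def)
  have ne: "S \<noteq> {}"
    using sub(1) set_pmf_not_empty by fast
  obtain s0 where "s0 \<in> set_pmf \<nu>"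
    using set_pmf_not_empty by fast
  \<comment> \<open>One step from \<open>s0\<close> reaches all of \<open>S\<close>, so by
    invariance \<open>\<nu>\<close> has full support and the ratios \<open>?r\<close> have positive
    denominators.\<close>
  then have "S \<subseteq> set_pmf (bind_pmf \<nu> K)"
    using K sub(2) by fastforce
  then have pos: "pmf \<nu> t > 0" if "t \<in> S" for t
    using that by (auto simp: inv pmf_positive)
  let ?r = "\<lambda>t. pmf \<mu> t / pmf \<nu> t"
  define c where "c = Min (?r ` S)"
  have "c \<in> ?r ` S"
    unfolding c_def using fin ne by (intro Min_in) auto
  then obtain t where t: "t \<in> S" "c = ?r t"
    by blast
  let ?D = "\<lambda>s. pmf \<mu> s - c * pmf \<nu> s"
  have nonneg: "?D s \<ge> 0" if "s \<in> S" for s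
  proof -
    have "c \<le> ?r s"
      unfolding c_def using fin that by auto
    then show ?thesis
      using pos[OF that] by (simp add: pos_le_divide_eq)
  qed
  \<comment> \<open>Invariance of \<open>?D\<close> is evaluated at the minimizer \<open>t\<close>,
    where \<open>?D\<close> vanishes; the terms are nonnegative, so each of them is zero.\<close>
  have "(\<Sum>s\<in>S. ?D s * pmf (K s) t) = pmf (bind_pmf \<mu> K) t - c * pmf (bind_pmf \<nu> K) t"
    unfolding pmf_bind_finite[OF fin sub(1)] pmf_bind_finite[OF fin sub(2)]
    by (simp add: sum_distrib_left sum_subtractf left_diff_distrib mult.assoc)
  also have "\<dots> = 0"
    using t pos[of t] by (simp add: inv)
  finally have zero: "\<forall>s\<in>S. ?D s * pmf (K s) t = 0"
    using nonneg fin by (subst (asm) sum_nonneg_eq_0_iff) auto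
  have D: "pmf \<mu> s = c * pmf \<nu> s" if "s \<in> S" for s
  proof -
    have "pmf (K s) t \<noteq> 0"
      using K[OF that] t(1) by (auto simp: set_pmf_iff)
    then show ?thesis using zero that by auto
  qed
  \<comment> \<open>Both distributions have total mass 1, which fixes the proportionality
    factor.\<close>
  have "1 = (\<Sum>s\<in>S. c * pmf \<nu> s)"
    using sum_pmf_subset_eq_1[OF fin sub(1)] D by simp
  also have "\<dots> = c"
    using sum_pmf_subset_eq_1[OF fin sub(2)] by (simp flip: sum_distrib_left)
  finally have c: "c = 1" ..
  show ?thesis
  proof (rule pmf_eqI)
    fix s
    show "pmf \<mu> s = pmf \<nu> s"
    proof (cases "s \<in> S")
      case True
      then show ?thesis using D c by simp
    next
      case False
      then have "s \<notin> set_pmf \<mu>" "s \<notin> set_pmf \<nu>"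
        using sub by auto
      then show ?thesis by (simp add: set_pmf_iff)
    qed
  qed
qed

text \<open>In product form the Gibbs weight can be merged with the independent percolation law one
  plaquette at a time.\<close>

lemma exp_potts_energy:
  assumes "finite (plaquettes X)"
  shows "exp (- \<beta> * potts_energy X f) =
    (\<Prod>x\<in>plaquettes X. if flat_at X f x then exp \<beta> else 1)"
proof -
  have "- \<beta> * potts_energy X f = (\<Sum>x\<in>plaquettes X. if flat_at X f x then \<beta> else 0)"
    unfolding potts_energy_def minus_mult_minus sum_distrib_left by (intro sum.cong) auto
  then show ?thesis
    using assms by (simp add: exp_sum if_distrib cong: if_cong)
qed

text \<open>This is the Edwards-Sokal weight: \<open>f\<close> survives only in the compatibility
  condition. Configurations that are \<open>False\<close> off the plaquettes are those on which
  \<open>Pi_pmf\<close> is a plain product. For \<open>\<beta> = 0\<close> the convention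
  \<open>0 ^ 0 = 1\<close> gives the empty percolation weight 1.\<close>

lemma potts_percolation_joint_weight:
  assumes fin: "finite (plaquettes X)" and "0 \<le> \<beta>" "p = 1 - exp (- \<beta>)"
    and \<omega>: "\<omega> \<in> PiE_dflt (plaquettes X) False (\<lambda>_. UNIV)"
  shows "exp (- \<beta> * potts_energy X f) *
      pmf (Pi_pmf (plaquettes X) False
        (\<lambda>x. if flat_at X f x then bernoulli_pmf p else return_pmf False)) \<omega> =
    (if \<forall>x\<in>plaquettes X. \<omega> x \<longrightarrow> flat_at X f x
     then (exp \<beta> - 1) ^ card {x \<in> plaquettes X. \<omega> x} else 0)"
    (is "_ * pmf (Pi_pmf ?U _ ?P) _ = _")
proof -
  have p: "0 \<le> p" "p \<le> 1"
    using assms by auto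
  \<comment> \<open>At a flat plaquette \<open>exp \<beta> * p = exp \<beta> - 1\<close> and
    \<open>exp \<beta> * (1 - p) = 1\<close>; any other plaquette is surely closed.\<close>
  have one: "(if flat_at X f x then exp \<beta> else 1) * pmf (?P x) (\<omega> x) =
      (if \<omega> x then if flat_at X f x then exp \<beta> - 1 else 0 else 1)" for x
    using p by (cases "\<omega> x") (auto simp: assms(3) right_diff_distrib simp flip: exp_add)
  have "pmf (Pi_pmf ?U False ?P) \<omega> = (\<Prod>x\<in>?U. pmf (?P x) (\<omega> x))"
    using \<omega> by (intro pmf_Pi'[OF fin]) (auto simp: PiE_dflt_def)
  then have "exp (- \<beta> * potts_energy X f) * pmf (Pi_pmf ?U False ?P) \<omega> =
      (\<Prod>x\<in>?U. if \<omega> x then if flat_at X f x then exp \<beta> - 1 else 0 else 1)"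
    by (simp only: exp_potts_energy[OF fin] one flip: prod.distrib)
  also have "\<dots> = (if \<forall>x\<in>?U. \<omega> x \<longrightarrow> flat_at X f x
     then (exp \<beta> - 1) ^ card {x \<in> ?U. \<omega> x} else 0)"
  proof (cases "\<forall>x\<in>?U. \<omega> x \<longrightarrow> flat_at X f x")
    case True
    then have "(\<Prod>x\<in>?U. if \<omega> x then if flat_at X f x then exp \<beta> - 1 else 0 else 1) =
        (\<Prod>x\<in>?U. if \<omega> x then exp \<beta> - 1 else 1)"
      by (intro prod.cong) auto
    also have "\<dots> = (exp \<beta> - 1) ^ card {x \<in> ?U. \<omega> x}"
      using fin by (simp add: Int_def flip: prod.inter_filter)
    finally show ?thesis using True by simp
  next
    case False
    then show ?thesis using fin by (auto intro!: prod_zero)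
  qed
  finally show ?thesis .
qed

lemma cocycles_open_plaquettes:
  "cocycles q (percolation_subcomplex X {x \<in> plaquettes X. \<omega> x}) =
    {f \<in> cochains q X. \<forall>x\<in>plaquettes X. \<omega> x \<longrightarrow> flat_at X f x}"
  by (subst percolation_subcomplex_cocycles) auto

text \<open>Compatibility of \<open>f\<close> with \<open>\<omega>\<close> is membership in
  \<open>Z\<close>, and uniform resampling contributes \<open>indicator Z g / card Z\<close>, so the
  sum is symmetric in \<open>f\<close> and \<open>g\<close>.\<close>

lemma potts_weight_swendsen_wang:
  assumes X: "finite_cubical_complex d X" and "q \<ge> 1" "0 \<le> \<beta>" "p = 1 - exp (- \<beta>)"
    and f: "f \<in> cochains q X"
  shows "exp (- \<beta> * potts_energy X f) * pmf (swendsen_wang q X p f) g =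
    (\<Sum>\<omega>\<in>PiE_dflt (plaquettes X) False (\<lambda>_. UNIV).
      let Z = cocycles q (percolation_subcomplex X {x \<in> plaquettes X. \<omega> x})
      in indicator Z f * indicator Z g * (exp \<beta> - 1) ^ card {x \<in> plaquettes X. \<omega> x} / card Z)"
    (is "_ = sum ?w ?\<Omega>")
proof -
  have fin: "finite (plaquettes X)"
    using finite_plaquettes[OF X] .
  have \<Omega>: "finite ?\<Omega>"
    using fin by (intro finite_PiE_dflt) auto
  let ?Q = "Pi_pmf (plaquettes X) False
    (\<lambda>x. if flat_at X f x then bernoulli_pmf p else return_pmf False)"
  let ?Z = "\<lambda>\<omega>. cocycles q (percolation_subcomplex X {x \<in> plaquettes X. \<omega> x})"
  \<comment> \<open>Finiteness and nonemptiness make \<open>pmf_of_set\<close> the uniform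
    law.\<close>
  have Z: "finite (?Z \<omega>)" "?Z \<omega> \<noteq> {}" for \<omega>
    using finite_cochains[OF X \<open>q \<ge> 1\<close>]
    by (simp add: cocycles_open_plaquettes, intro cocycles_percolation_not_empty[OF X]) auto
  have "set_pmf ?Q \<subseteq> ?\<Omega>"
    by (auto simp: PiE_dflt_def set_Pi_pmf[OF fin])
  then have "exp (- \<beta> * potts_energy X f) * pmf (swendsen_wang q X p f) g =
      (\<Sum>\<omega>\<in>?\<Omega>. exp (- \<beta> * potts_energy X f) * pmf ?Q \<omega> * pmf (pmf_of_set (?Z \<omega>)) g)"
    by (simp add: swendsen_wang_def pmf_bind_finite[OF \<Omega>] sum_distrib_left mult.assoc)
  also have "\<dots> = sum ?w ?\<Omega>"
  proof (intro sum.cong refl)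
    fix \<omega> assume "\<omega> \<in> ?\<Omega>"
    from potts_percolation_joint_weight[OF fin assms(3,4) this]
    show "exp (- \<beta> * potts_energy X f) * pmf ?Q \<omega> * pmf (pmf_of_set (?Z \<omega>)) g = ?w \<omega>"
      using f Z[of \<omega>] by (simp add: Let_def indicator_def cocycles_open_plaquettes)
  qed
  finally show ?thesis .
qed

lemma reversible_swendsen_wang:
  assumes X: "finite_cubical_complex d X" and q: "q \<ge> 1" and "0 \<le> \<beta>" "p = 1 - exp (- \<beta>)"
  shows "reversible_distribution (cochains q X) (swendsen_wang q X p) (potts_gauge q X \<beta>)"
  unfolding reversible_distribution_def
proof (intro conjI ballI)
  show "set_pmf (potts_gauge q X \<beta>) \<subseteq> cochains q X"
    by (auto simp: set_pmf_iff pmf_potts_gauge[OF X q] split: if_splits)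
next
  fix f g assume fg: "f \<in> cochains q X" "g \<in> cochains q X"
  \<comment> \<open>Exchanging \<open>f\<close> and \<open>g\<close> only swaps the two indicators;
    the partition function is a common divisor of both sides.\<close>
  have "exp (- \<beta> * potts_energy X f) * pmf (swendsen_wang q X p f) g =
      exp (- \<beta> * potts_energy X g) * pmf (swendsen_wang q X p g) f"
    unfolding potts_weight_swendsen_wang[OF assms fg(1)] potts_weight_swendsen_wang[OF assms fg(2)]
    by (simp add: Let_def mult_ac)
  then show "pmf (potts_gauge q X \<beta>) f * pmf (swendsen_wang q X p f) g =
      pmf (potts_gauge q X \<beta>) g * pmf (swendsen_wang q X p g) f"
    using fg by (simp add: pmf_potts_gauge[OF X q])
qed

lemma swendsen_wang_positive:
  assumes X: "finite_cubical_complex d X" and "q \<ge> 1" "0 \<le> p" "p < 1"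
  shows "cochains q X \<subseteq> set_pmf (swendsen_wang q X p f)"
proof -
  let ?Q = "Pi_pmf (plaquettes X) False
    (\<lambda>x. if flat_at X f x then bernoulli_pmf p else return_pmf False)"
  let ?Z = "\<lambda>\<omega>. cocycles q (percolation_subcomplex X {x \<in> plaquettes X. \<omega> x})"
  have "(\<lambda>_. False) \<in> set_pmf ?Q"
    using assms by (auto simp: set_Pi_pmf finite_plaquettes[OF X] PiE_dflt_def set_pmf_iff)
  \<comment> \<open>With no open plaquette the cocycle condition is void, so the uniform law charges
    every cochain.\<close>
  moreover have "set_pmf (pmf_of_set (?Z (\<lambda>_. False))) = cochains q X"
    using finite_cochains[OF X \<open>q \<ge> 1\<close>] cochains_not_empty
    by (subst cocycles_open_plaquettes) (simp add: set_pmf_of_set)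
  ultimately show ?thesis
    unfolding swendsen_wang_def set_bind_pmf by blast
qed

theorem theorem4:
  fixes d q :: nat and \<beta> p :: real and X :: cubical_complex
  assumes "finite_cubical_complex d X"
    and "q \<ge> 2"
    and "0 \<le> \<beta>"
    and "p = 1 - exp (- \<beta>)"
  shows "reversible_distribution (cochains q X) (swendsen_wang q X p) (potts_gauge q X \<beta>) \<and>
         stationary_distribution (cochains q X) (swendsen_wang q X p) (potts_gauge q X \<beta>) \<and>
         (\<forall>\<mu>. stationary_distribution (cochains q X) (swendsen_wang q X p) \<mu>
              \<longrightarrow> \<mu> = potts_gauge q X \<beta>)"
proof -
  have q: "q \<ge> 1" and p: "0 \<le> p" "p < 1"
    using assms by auto
  note fin = finite_cochains[OF assms(1) q]
  have rev: "reversible_distribution (cochains q X) (swendsen_wang q X p) (potts_gauge q X \<beta>)"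
    using reversible_swendsen_wang[OF assms(1) q assms(3,4)] .
  have stat: "stationary_distribution (cochains q X) (swendsen_wang q X p) (potts_gauge q X \<beta>)"
    using reversible_imp_stationary[OF fin rev] set_pmf_swendsen_wang[OF assms(1) q] .
  show ?thesis
    using rev stat
      stationary_distribution_unique[OF fin swendsen_wang_positive[OF assms(1) q p] _ stat]
    by blast
qed

end
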